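(* Let $\mathcal{C}$ be an analytic curve, let $q\ge 2$, and let $M_1,\dots,M_q:\mathcal{C}\to \mathrm{SL}_n(\mathbb{C})$ be analytic maps. Suppose $M_1$ and $M_2$ are irreducible on $\mathcal{C}$ except at a subset of isolated points. Then the following are equivalent: (i) $M_1,\dots,M_q$ are globally simultaneously unitarizable on $\mathcal{C}$. (ii) $M_1,\dots,M_q$ are locally simultaneously unitarizable at each $p\in\mathcal{C}$. In this case, any simultaneous unitarizer $V$ is unique up to left multiplication by an analytic map $\mathcal{C}\to \mathrm{SU}_n$.
   Context: An analytic curve is a connected real analytic one-dimensional manifold without boundary; "analytic" means real analytic. $\mathrm{SU}_n\subset \mathrm{SL}_n(\mathbb{C})$ is the special unitary group. Two matrices $A,B\in M_{n\times n}(\mathbb{C})$ are reducible if there is a proper nonzero subspace $W\subset\mathbb{C}^n$ with $AW\subset W$ and $BW\subset W$, and irreducible otherwise; for maps this is understood pointwise. Analytic maps $M_1,\dots,M_q:\mathcal{C}\to\mathrm{SL}_n(\mathbb{C})$ are (globally) simultaneously unitarizable on $\mathcal{C}$ if there is an analytic map $V:\mathcal{C}\to\mathrm{SL}_n(\mathbb{C})$ (a simultaneous unitarizer) such that every $VM_kV^{-1}$ takes values in $\mathrm{SU}_n$. They are locally simultaneously unitarizable at $p\in\mathcal{C}$ if there are a neighborhood $\mathcal{U}\subseteq\mathcal{C}$ of $p$ and an analytic map $V:\mathcal{U}\to\mathrm{SL}_n(\mathbb{C})$ such that every $VM_kV^{-1}$ takes values in $\mathrm{SU}_n$ on $\mathcal{U}$.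 *)

theory Defs
  imports "HOL-Analysis.Analysis"
begin

text \<open>
  Only points of \<open>S\<close> are constrained, but each of them needs a power series that converges to
  \<open>f\<close> on a full neighbourhood in the reals; the definition is meant for open \<open>S\<close>.
\<close>

definition real_analytic_on :: "(real \<Rightarrow> 'b::real_normed_vector) \<Rightarrow> real set \<Rightarrow> bool"
  where "real_analytic_on f S \<longleftrightarrow>
    (\<forall>x\<in>S. \<exists>a. \<exists>r>0. \<forall>y. \<bar>y - x\<bar> < r \<longrightarrow> (\<lambda>k. (y - x) ^ k *\<^sub>R a k) sums f y)"

text \<open>
  A chart is a pair \<open>(U, \<phi>)\<close> where \<open>\<phi>\<close> is relevant on \<open>U\<close> only. The atlas is not required
  to be maximal.
\<close>

type_synonym 'c chart = "'c set \<times> ('c \<Rightarrow> real)"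

definition is_chart :: "'c topology \<Rightarrow> 'c set \<Rightarrow> ('c \<Rightarrow> real) \<Rightarrow> bool"
  where "is_chart X U \<phi> \<longleftrightarrow>
    openin X U \<and> open (\<phi> ` U) \<and>
    homeomorphic_map (subtopology X U) (top_of_set (\<phi> ` U)) \<phi>"

definition analytic_atlas :: "'c topology \<Rightarrow> 'c chart set \<Rightarrow> bool"
  where "analytic_atlas X \<A> \<longleftrightarrow>
    (\<forall>(U, \<phi>)\<in>\<A>. is_chart X U \<phi>) \<and>
    (\<Union>(U, \<phi>)\<in>\<A>. U) = topspace X \<and>
    (\<forall>(U, \<phi>)\<in>\<A>. \<forall>(U', \<phi>')\<in>\<A>.
       real_analytic_on (\<phi>' \<circ> inv_into U \<phi>) (\<phi> ` (U \<inter> U')))"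

definition analytic_curve :: "'c topology \<Rightarrow> 'c chart set \<Rightarrow> bool"
  where "analytic_curve X \<A> \<longleftrightarrow>
    Hausdorff_space X \<and> second_countable X \<and> connected_space X \<and> analytic_atlas X \<A>"

text \<open>Analyticity of a map on an open subset \<open>D\<close> of the curve with atlas \<open>\<A>\<close>.\<close>

definition analytic_map_on ::
    "'c chart set \<Rightarrow> 'c set \<Rightarrow> ('c \<Rightarrow> 'b::real_normed_vector) \<Rightarrow> bool"
  where "analytic_map_on \<A> D f \<longleftrightarrow>
    (\<forall>(U, \<phi>)\<in>\<A>. real_analytic_on (f \<circ> inv_into U \<phi>) (\<phi> ` (U \<inter> D)))"

definition conj_transpose :: "complex^'n^'n \<Rightarrow> complex^'n^'n"
  where "conj_transpose A = (\<chi> i j. cnj (A $ j $ i))"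

definition SL :: "(complex^'n^'n) set"
  where "SL = {A. det A = 1}"

definition SU :: "(complex^'n^'n) set"
  where "SU = {A \<in> SL. conj_transpose A ** A = mat 1}"

text \<open>
  The subspaces are complex: \<open>vec.subspace\<close> refers to \<open>(*s)\<close>, whereas plain \<open>subspace\<close>
  would allow real subspaces.
\<close>

definition reducible_pair :: "complex^'n^'n \<Rightarrow> complex^'n^'n \<Rightarrow> bool"
  where "reducible_pair A B \<longleftrightarrow>
    (\<exists>W. vec.subspace W \<and> W \<noteq> {0} \<and> W \<noteq> UNIV \<and>
       (\<forall>w\<in>W. A *v w \<in> W) \<and> (\<forall>w\<in>W. B *v w \<in> W))"

definition simultaneous_unitarizer ::
    "'c chart set \<Rightarrow> 'c set \<Rightarrow> nat \<Rightarrow> (nat \<Rightarrow> 'c \<Rightarrow> complex^'n^'n) \<Rightarrow> ('c \<Rightarrow> complex^'n^'n) \<Rightarrow> bool"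
  where "simultaneous_unitarizer \<A> D q M V \<longleftrightarrow>
    analytic_map_on \<A> D V \<and> (\<forall>p\<in>D. V p \<in> SL) \<and>
    (\<forall>k\<in>{1..q}. \<forall>p\<in>D. V p ** M k p ** matrix_inv (V p) \<in> SU)"

definition globally_unitarizable ::
    "'c topology \<Rightarrow> 'c chart set \<Rightarrow> nat \<Rightarrow> (nat \<Rightarrow> 'c \<Rightarrow> complex^'n^'n) \<Rightarrow> bool"
  where "globally_unitarizable X \<A> q M \<longleftrightarrow>
    (\<exists>V. simultaneous_unitarizer \<A> (topspace X) q M V)"

definition locally_unitarizable_at ::
    "'c topology \<Rightarrow> 'c chart set \<Rightarrow> nat \<Rightarrow> (nat \<Rightarrow> 'c \<Rightarrow> complex^'n^'n) \<Rightarrow> 'c \<Rightarrow> bool"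
  where "locally_unitarizable_at X \<A> q M p \<longleftrightarrow>
    (\<exists>D V. openin X D \<and> p \<in> D \<and> simultaneous_unitarizer \<A> D q M V)"

end

theory Submission
  imports Defs "HOL-Complex_Analysis.Cauchy_Integral_Formula"
begin

text \<open>
  A unitarizer \<open>V\<close> is determined up to a left unitary factor by the positive definite matrix
  \<open>H = V\<^sup>* V\<close>, and \<open>V M V\<^sup>-\<^sup>1\<close> is special unitary for \<open>M\<close> in \<open>SL\<close> exactly when \<open>M\<close> preserves the norm
  \<open>x \<mapsto> \<parallel>V x\<parallel>\<close> that \<open>H\<close> defines (lemmas \<open>gram_eq_iff_norm_eq\<close> and \<open>conjugate_in_SU_iff\<close>). An
  irreducible pair of matrices has at most one such invariant norm with \<open>det H = 1\<close> (lemma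
  \<open>invariant_norm_unique\<close>). Any two unitarizers therefore give the same \<open>H\<close> at the irreducible
  points, and by continuity at the isolated exceptional points as well (lemma
  \<open>simultaneous_unitarizer_gram_unique\<close>). This is the uniqueness statement, and it shows that the
  matrices \<open>H\<close> of the local unitarizers fit together to one analytic map on the whole curve.

  It remains to recover a global \<open>V\<close> from \<open>H\<close>. There is no obstruction from the topology of the
  curve, because symmetric elimination solves \<open>H = C\<^sup>* C\<close> by explicit formulas that are analytic in the
  real and imaginary parts of the entries of \<open>H\<close> (theorem \<open>analytic_cholesky\<close>). The map \<open>p \<mapsto> C (H p)\<close>
  is then a unitarizer on the whole curve, since it induces the same norm at each point as the
  local unitarizers.
\<close>

section \<open>Real analytic functions of a real variable\<close>

lemma real_analytic_on_bounded_linear: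
  assumes "bounded_linear h" and f: "real_analytic_on f S"
  shows "real_analytic_on (\<lambda>x. h (f x)) S"
  unfolding real_analytic_on_def
proof
  interpret bounded_linear h by fact
  fix x assume "x \<in> S"
  then obtain a r where "r > 0" and ar: "\<And>y. \<bar>y - x\<bar> < r \<Longrightarrow> (\<lambda>k. (y - x) ^ k *\<^sub>R a k) sums f y"
    using f unfolding real_analytic_on_def by meson
  have "(\<lambda>k. (y - x) ^ k *\<^sub>R h (a k)) sums h (f y)" if "\<bar>y - x\<bar> < r" for y
    using sums[OF ar[OF that]] by (simp add: scaleR)
  with \<open>r > 0\<close> show "\<exists>a. \<exists>r>0. \<forall>y. \<bar>y - x\<bar> < r \<longrightarrow> (\<lambda>k. (y - x) ^ k *\<^sub>R a k) sums h (f y)"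
    by (intro exI[of _ "\<lambda>k. h (a k)"] exI[of _ r]) blast
qed

lemma real_analytic_on_cong_nhd:
  assumes f: "real_analytic_on f T" and "x \<in> T" and "open U" and "x \<in> U"
    and eq: "\<And>y. y \<in> U \<Longrightarrow> g y = f y"
  shows "real_analytic_on g {x}"
proof -
  obtain a r where "r > 0" and ar: "\<And>y. \<bar>y - x\<bar> < r \<Longrightarrow> (\<lambda>k. (y - x) ^ k *\<^sub>R a k) sums f y"
    using f \<open>x \<in> T\<close> unfolding real_analytic_on_def by meson
  obtain e where "e > 0" and e: "ball x e \<subseteq> U"
    using \<open>open U\<close> \<open>x \<in> U\<close> openE by blast
  have "(\<lambda>k. (y - x) ^ k *\<^sub>R a k) sums g y" if "\<bar>y - x\<bar> < min r e" for y
  proof -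
    have "y \<in> U"
      using e that by (auto simp: dist_real_def)
    then show ?thesis
      using ar[of y] eq[of y] that by simp
  qed
  moreover have "min r e > 0"
    using \<open>r > 0\<close> \<open>e > 0\<close> by simp
  ultimately show ?thesis
    unfolding real_analytic_on_def by blast
qed

lemma real_analytic_on_pointwise:
  "real_analytic_on f S \<longleftrightarrow> (\<forall>x\<in>S. real_analytic_on f {x})"
  unfolding real_analytic_on_def by blast

text \<open>
  A real power series with complex coefficients also converges on the complex disc of the same
  radius, and a holomorphic function on a disc is the sum of its Taylor series. Closure under
  multiplication, division and square roots is therefore inherited from holomorphic functions,
  without any computation with coefficients.
\<close>

lemma real_analytic_on_iff_holomorphic_extension:
  fixes f :: "real \<Rightarrow> complex"
  shows "real_analytic_on f S \<longleftrightarrow>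
    (\<forall>x\<in>S. \<exists>F. \<exists>r>0. F holomorphic_on ball (of_real x) r \<and>
       (\<forall>y. \<bar>y - x\<bar> < r \<longrightarrow> F (of_real y) = f y))" (is "_ \<longleftrightarrow> (\<forall>x\<in>S. ?ext x)")
proof
  assume f: "real_analytic_on f S"
  show "\<forall>x\<in>S. ?ext x"
  proof
    fix x assume "x \<in> S"
    then obtain a r where "r > 0" and ar: "\<And>y. \<bar>y - x\<bar> < r \<Longrightarrow> (\<lambda>k. (y - x) ^ k *\<^sub>R a k) sums f y"
      using f unfolding real_analytic_on_def by meson
    define F where "F z = (\<Sum>k. a k * (z - of_real x) ^ k)" for z
    have "(\<lambda>k. a k * (z - of_real x) ^ k) sums F z" if "z \<in> ball (of_real x) r" for z
    proof -
      have "cmod (z - of_real x) < r"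
        using that by (simp add: dist_norm norm_minus_commute)
      then obtain t where t: "cmod (z - of_real x) < t" "t < r"
        using dense by blast
      then have "0 < t"
        using norm_ge_zero order_le_less_trans by blast
      have "(\<lambda>k. t ^ k *\<^sub>R a k) sums f (x + t)"
        using ar[of "x + t"] \<open>0 < t\<close> \<open>t < r\<close> by simp
      then have "summable (\<lambda>k. a k * of_real t ^ k)"
        by (simp add: scaleR_conv_of_real mult.commute sums_iff)
      from powser_inside[OF this, of "z - of_real x"] t \<open>0 < t\<close>
      show ?thesis
        unfolding F_def by (simp add: summable_sums)
    qed
    then have "F holomorphic_on ball (of_real x) r"
      by (rule power_series_holomorphic)
    moreover have "F (of_real y) = f y" if "\<bar>y - x\<bar> < r" for y
    proof -
      have "(\<lambda>k. a k * (of_real y - of_real x) ^ k) sums f y"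
        using ar[OF that] by (simp add: scaleR_conv_of_real mult.commute)
      then show ?thesis
        unfolding F_def by (simp add: sums_iff)
    qed
    ultimately show "?ext x"
      using \<open>r > 0\<close> by blast
  qed
next
  assume ext: "\<forall>x\<in>S. ?ext x"
  show "real_analytic_on f S"
    unfolding real_analytic_on_def
  proof
    fix x assume "x \<in> S"
    then obtain F r where "r > 0" and F: "F holomorphic_on ball (of_real x) r"
      and eq: "\<And>y. \<bar>y - x\<bar> < r \<Longrightarrow> F (of_real y) = f y"
      using ext by meson
    have "(\<lambda>k. (y - x) ^ k *\<^sub>R ((deriv ^^ k) F (of_real x) / fact k)) sums f y" if "\<bar>y - x\<bar> < r" for y
    proof -
      have "complex_of_real y \<in> ball (of_real x) r"
        using that by (simp add: dist_of_real dist_real_def abs_minus_commute)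
      from holomorphic_power_series[OF F this] eq[OF that] show ?thesis
        by (simp add: scaleR_conv_of_real mult.commute)
    qed
    with \<open>r > 0\<close> show "\<exists>a. \<exists>r>0. \<forall>y. \<bar>y - x\<bar> < r \<longrightarrow> (\<lambda>k. (y - x) ^ k *\<^sub>R a k) sums f y"
      by (intro exI[of _ "\<lambda>k. (deriv ^^ k) F (of_real x) / fact k"] exI[of _ r]) blast
  qed
qed

lemma real_analytic_on_const: "real_analytic_on (\<lambda>x. c :: complex) S"
  unfolding real_analytic_on_iff_holomorphic_extension
  by (intro ballI exI[of _ "\<lambda>_. c"] exI[of _ 1]) simp

text \<open>
  Shrinking the disc of the holomorphic extensions keeps the values of \<open>G\<close> inside any given open
  set that contains \<open>g x\<close>. This is what lets division avoid the zeros of the denominator, and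
  square roots the branch cut, from a condition on the real points alone.
\<close>

lemma real_analytic_on_binary:
  fixes f g :: "real \<Rightarrow> complex"
  assumes f: "real_analytic_on f S" and g: "real_analytic_on g S"
    and "open T" and T: "\<And>x. x \<in> S \<Longrightarrow> g x \<in> T"
    and h: "\<And>A F G. F holomorphic_on A \<Longrightarrow> G holomorphic_on A \<Longrightarrow> G ` A \<subseteq> T \<Longrightarrow>
      (\<lambda>z. h (F z) (G z)) holomorphic_on A"
  shows "real_analytic_on (\<lambda>x. h (f x) (g x)) S"
  unfolding real_analytic_on_iff_holomorphic_extension
proof
  fix x assume "x \<in> S"
  then obtain F r where "r > 0" and F: "F holomorphic_on ball (of_real x) r"
    and Ff: "\<And>y. \<bar>y - x\<bar> < r \<Longrightarrow> F (of_real y) = f y"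
    using f unfolding real_analytic_on_iff_holomorphic_extension by meson
  obtain G s where "s > 0" and G: "G holomorphic_on ball (of_real x) s"
    and Gg: "\<And>y. \<bar>y - x\<bar> < s \<Longrightarrow> G (of_real y) = g y"
    using g \<open>x \<in> S\<close> unfolding real_analytic_on_iff_holomorphic_extension by meson
  have "G (of_real x) \<in> T"
    using Gg[of x] T[OF \<open>x \<in> S\<close>] \<open>s > 0\<close> by simp
  moreover have "open (G -` T \<inter> ball (of_real x) s)"
    using continuous_open_preimage[OF holomorphic_on_imp_continuous_on[OF G] open_ball \<open>open T\<close>]
    by (simp add: Int_commute)
  ultimately obtain e where "e > 0" and e: "ball (of_real x) e \<subseteq> G -` T \<inter> ball (of_real x) s"
    using \<open>s > 0\<close> by (metis IntI centre_in_ball openE vimageI)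
  define d where "d = min r e"
  have "d > 0"
    using \<open>r > 0\<close> \<open>e > 0\<close> by (simp add: d_def)
  have sub: "ball (complex_of_real x) d \<subseteq> ball (of_real x) r"
       "ball (complex_of_real x) d \<subseteq> ball (of_real x) s"
       "G ` ball (of_real x) d \<subseteq> T"
    using e by (auto simp: d_def)
  have "(\<lambda>z. h (F z) (G z)) holomorphic_on ball (of_real x) d"
    using sub F G by (intro h) (blast intro: holomorphic_on_subset)+
  moreover have "h (F (of_real y)) (G (of_real y)) = h (f y) (g y)" if "\<bar>y - x\<bar> < d" for y
  proof -
    have "complex_of_real y \<in> ball (of_real x) d"
      using that by (simp add: dist_of_real dist_real_def abs_minus_commute)
    then have "complex_of_real y \<in> ball (of_real x) r \<inter> ball (of_real x) s"
      using sub by blast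
    then show ?thesis
      using Ff[of y] Gg[of y] by (simp add: dist_of_real dist_real_def abs_minus_commute)
  qed
  ultimately show "\<exists>H. \<exists>r>0. H holomorphic_on ball (of_real x) r \<and>
      (\<forall>y. \<bar>y - x\<bar> < r \<longrightarrow> H (of_real y) = h (f y) (g y))"
    using \<open>d > 0\<close> by (intro exI[of _ "\<lambda>z. h (F z) (G z)"] exI[of _ d]) blast
qed

lemma
  fixes f g :: "real \<Rightarrow> complex"
  assumes "real_analytic_on f S" and "real_analytic_on g S"
  shows real_analytic_on_add: "real_analytic_on (\<lambda>x. f x + g x) S"
    and real_analytic_on_mult: "real_analytic_on (\<lambda>x. f x * g x) S"
    and real_analytic_on_diff: "real_analytic_on (\<lambda>x. f x - g x) S"
  by (rule real_analytic_on_binary[OF assms open_UNIV]; auto intro: holomorphic_intros)+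

lemma real_analytic_on_divide:
  fixes f g :: "real \<Rightarrow> complex"
  assumes "real_analytic_on f S" and "real_analytic_on g S" and "\<And>x. x \<in> S \<Longrightarrow> g x \<noteq> 0"
  shows "real_analytic_on (\<lambda>x. f x / g x) S"
  by (rule real_analytic_on_binary[OF assms(1,2), of "- {0}"]; use assms(3) in \<open>auto intro!: holomorphic_intros\<close>)

lemma real_analytic_on_csqrt:
  fixes f :: "real \<Rightarrow> complex"
  assumes "real_analytic_on f S" and "\<And>x. x \<in> S \<Longrightarrow> f x \<notin> \<real>\<^sub>\<le>\<^sub>0"
  shows "real_analytic_on (\<lambda>x. csqrt (f x)) S"
  by (rule real_analytic_on_binary[OF assms(1) assms(1), of "- \<real>\<^sub>\<le>\<^sub>0" "\<lambda>_. csqrt"])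
    (use assms(2) in \<open>auto intro!: holomorphic_intros\<close>)

lemma real_analytic_on_sum:
  fixes f :: "'i \<Rightarrow> real \<Rightarrow> complex"
  assumes "\<And>i. i \<in> I \<Longrightarrow> real_analytic_on (f i) S"
  shows "real_analytic_on (\<lambda>x. \<Sum>i\<in>I. f i x) S"
  using assms
  by (induction I rule: infinite_finite_induct)
    (auto intro: real_analytic_on_const real_analytic_on_add)

lemma real_analytic_on_prod:
  fixes f :: "'i \<Rightarrow> real \<Rightarrow> complex"
  assumes "\<And>i. i \<in> I \<Longrightarrow> real_analytic_on (f i) S"
  shows "real_analytic_on (\<lambda>x. \<Prod>i\<in>I. f i x) S"
  using assms
  by (induction I rule: infinite_finite_induct)
    (auto intro: real_analytic_on_const real_analytic_on_mult)

lemma real_analytic_on_if: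
  assumes "b \<Longrightarrow> real_analytic_on f S" and "\<not> b \<Longrightarrow> real_analytic_on g S"
  shows "real_analytic_on (\<lambda>x. if b then f x else g x) S"
  using assms by (cases b) simp_all

lemma real_analytic_on_imp_isCont:
  fixes f :: "real \<Rightarrow> complex"
  assumes "real_analytic_on f S" and "x \<in> S"
  shows "isCont f x"
proof -
  obtain F r where "r > 0" and F: "F holomorphic_on ball (of_real x) r"
    and Ff: "\<And>y. \<bar>y - x\<bar> < r \<Longrightarrow> F (of_real y) = f y"
    using assms unfolding real_analytic_on_iff_holomorphic_extension by meson
  have "isCont F (of_real x)"
    using holomorphic_on_imp_continuous_on[OF F] \<open>r > 0\<close>
    by (simp add: continuous_on_eq_continuous_at)
  then have "isCont (\<lambda>y. F (of_real y)) x"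
    by (intro isCont_o2[of x complex_of_real F] isCont_of_real continuous_ident)
  moreover have "\<forall>\<^sub>F y in nhds x. F (of_real y) = f y"
    using Ff \<open>r > 0\<close> by (auto simp: eventually_nhds_metric dist_real_def)
  ultimately show ?thesis
    by (simp add: isCont_cong)
qed

lemma real_analytic_on_eq_at_limit:
  fixes f g :: "real \<Rightarrow> complex"
  assumes "real_analytic_on f S" and "real_analytic_on g S" and "x \<in> S"
    and "open U" and "x \<in> U" and eq: "\<And>y. y \<in> U \<Longrightarrow> y \<noteq> x \<Longrightarrow> f y = g y"
  shows "f x = g x"
proof -
  have "f \<midarrow>x\<rightarrow> f x" and g: "g \<midarrow>x\<rightarrow> g x"
    using assms real_analytic_on_imp_isCont by (auto simp: isCont_def)
  moreover have "\<forall>\<^sub>F y in at x. f y = g y"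
    using eventually_at_topological eq \<open>open U\<close> \<open>x \<in> U\<close> by blast
  ultimately have "g \<midarrow>x\<rightarrow> f x"
    using tendsto_cong by force
  then show ?thesis
    using g LIM_unique by blast
qed

section \<open>Real analytic matrices\<close>

lemma real_analytic_on_vec:
  fixes f :: "real \<Rightarrow> 'b::real_normed_vector^'n"
  shows "real_analytic_on f S \<longleftrightarrow> (\<forall>i. real_analytic_on (\<lambda>x. f x $ i) S)"
proof
  assume "real_analytic_on f S"
  then show "\<forall>i. real_analytic_on (\<lambda>x. f x $ i) S"
    using real_analytic_on_bounded_linear[OF bounded_linear_vec_nth] by blast
next
  assume f: "\<forall>i. real_analytic_on (\<lambda>x. f x $ i) S"
  show "real_analytic_on f S"
    unfolding real_analytic_on_def
  proof
    fix x assume "x \<in> S"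
    then have "\<forall>i. \<exists>a. \<exists>r>0. \<forall>y. \<bar>y - x\<bar> < r \<longrightarrow> (\<lambda>k. (y - x) ^ k *\<^sub>R a k) sums (f y $ i)"
      using f unfolding real_analytic_on_def by blast
    then obtain a r where r: "\<And>i. r i > 0" and ar: "\<And>i y. \<bar>y - x\<bar> < r i \<Longrightarrow>
        (\<lambda>k. (y - x) ^ k *\<^sub>R a i k) sums (f y $ i)"
      by metis
    have "(\<lambda>k. (y - x) ^ k *\<^sub>R (\<chi> i. a i k)) sums f y" if "\<bar>y - x\<bar> < Min (range r)" for y
    proof -
      have "(\<lambda>k. (y - x) ^ k *\<^sub>R a i k) sums (f y $ i)" for i
        using that by (intro ar) auto
      then show ?thesis
        unfolding sums_def by (intro vec_tendstoI) (simp add: sum_component)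
    qed
    moreover have "Min (range r) > 0"
      using r by simp
    ultimately show "\<exists>a. \<exists>r>0. \<forall>y. \<bar>y - x\<bar> < r \<longrightarrow> (\<lambda>k. (y - x) ^ k *\<^sub>R a k) sums f y"
      by (intro exI[of _ "\<lambda>k. \<chi> i. a i k"] exI[of _ "Min (range r)"]) blast
  qed
qed

lemma real_analytic_on_matrix:
  fixes A :: "real \<Rightarrow> complex^'n^'m"
  shows "real_analytic_on A S \<longleftrightarrow> (\<forall>i j. real_analytic_on (\<lambda>x. A x $ i $ j) S)"
  by (simp add: real_analytic_on_vec)

lemma real_analytic_on_matrix_mult:
  fixes A :: "real \<Rightarrow> complex^'n^'m" and B :: "real \<Rightarrow> complex^'k^'n"
  assumes "real_analytic_on A S" and "real_analytic_on B S"
  shows "real_analytic_on (\<lambda>x. A x ** B x) S"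
  using assms unfolding real_analytic_on_matrix
  by (simp add: matrix_matrix_mult_def real_analytic_on_sum real_analytic_on_mult)

lemma real_analytic_on_conj_transpose:
  assumes "real_analytic_on A S"
  shows "real_analytic_on (\<lambda>x. conj_transpose (A x)) S"
  using assms unfolding real_analytic_on_matrix
  by (simp add: conj_transpose_def real_analytic_on_bounded_linear[OF bounded_linear_cnj])

lemma real_analytic_on_det:
  fixes A :: "real \<Rightarrow> complex^'n^'n"
  assumes "real_analytic_on A S"
  shows "real_analytic_on (\<lambda>x. det (A x)) S"
  using assms unfolding real_analytic_on_matrix det_def
  by (intro real_analytic_on_sum real_analytic_on_mult real_analytic_on_prod real_analytic_on_const) blast

lemma matrix_inv_inverse:
  fixes A :: "complex^'n^'n"
  assumes "det A \<noteq> 0"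
  shows matrix_inv_right: "A ** matrix_inv A = mat 1" and matrix_inv_left: "matrix_inv A ** A = mat 1"
proof -
  have "\<exists>B. A ** B = mat 1 \<and> B ** A = mat 1"
    using assms invertible_det_nz[of A] by (simp add: invertible_def)
  then have "A ** matrix_inv A = mat 1 \<and> matrix_inv A ** A = mat 1"
    unfolding matrix_inv_def by (rule someI_ex)
  then show "A ** matrix_inv A = mat 1" and "matrix_inv A ** A = mat 1"
    by auto
qed

text \<open>
  By Cramer's rule the entries of the inverse are quotients of determinants. The formula is
  available on \<open>S\<close> only, and analyticity is a statement about neighbourhoods; hence \<open>S\<close> is open.
\<close>

lemma real_analytic_on_matrix_inv:
  fixes A :: "real \<Rightarrow> complex^'n^'n"
  assumes A: "real_analytic_on A S" and "open S" and det: "\<And>x. x \<in> S \<Longrightarrow> det (A x) \<noteq> 0"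
  shows "real_analytic_on (\<lambda>x. matrix_inv (A x)) S"
  unfolding real_analytic_on_matrix
proof (intro allI)
  fix i j
  define c where "c x = det (\<chi> k l. if l = i then axis j 1 $ k else A x $ k $ l) / det (A x)" for x
  have cramer_entry: "matrix_inv (A x) $ i $ j = c x" if "x \<in> S" for x
  proof -
    have "A x *v (matrix_inv (A x) *v axis j 1) = axis j 1"
      by (simp add: matrix_vector_mul_assoc matrix_inv_right det that)
    then have "matrix_inv (A x) *v axis j 1 =
        (\<chi> i. det (\<chi> k l. if l = i then axis j 1 $ k else A x $ k $ l) / det (A x))"
      using cramer[OF det[OF that]] by blast
    moreover have "(matrix_inv (A x) *v axis j 1) $ i = matrix_inv (A x) $ i $ j"
      by (simp add: matrix_vector_mult_def axis_def if_distrib cong: if_cong)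
    ultimately show ?thesis
      by (simp add: c_def)
  qed
  have "real_analytic_on (\<lambda>x. A x $ k $ l) S" for k l
    using A by (simp add: real_analytic_on_matrix)
  then have "real_analytic_on (\<lambda>x. \<chi> k l. if l = i then axis j 1 $ k else A x $ k $ l) S"
    unfolding real_analytic_on_matrix
  proof (intro allI)
    fix k l
    show "real_analytic_on (\<lambda>x. (\<chi> k l. if l = i then axis j 1 $ k else A x $ k $ l) $ k $ l) S"
      using \<open>\<And>k l. real_analytic_on (\<lambda>x. A x $ k $ l) S\<close>
      by (cases "l = i") (simp_all add: real_analytic_on_const)
  qed
  then have "real_analytic_on c S"
    unfolding c_def by (intro real_analytic_on_divide real_analytic_on_det A det)
  then show "real_analytic_on (\<lambda>x. matrix_inv (A x) $ i $ j) S"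
    by (subst real_analytic_on_pointwise)
      (intro ballI real_analytic_on_cong_nhd[OF _ _ \<open>open S\<close> _ cramer_entry])
qed

section \<open>Unitary matrices\<close>

lemma inner_conj_transpose:
  fixes A :: "complex^'n^'n"
  shows "(A *v x) \<bullet> y = x \<bullet> (conj_transpose A *v y)"
proof -
  have "(A *v x) \<bullet> y = (\<Sum>i\<in>UNIV. \<Sum>j\<in>UNIV. (A $ i $ j * x $ j) \<bullet> (y $ i))"
    by (simp add: inner_vec_def matrix_vector_mult_def inner_sum_left)
  also have "\<dots> = (\<Sum>j\<in>UNIV. \<Sum>i\<in>UNIV. (A $ i $ j * x $ j) \<bullet> (y $ i))"
    by (rule sum.swap)
  also have "\<dots> = (\<Sum>j\<in>UNIV. \<Sum>i\<in>UNIV. (x $ j) \<bullet> (cnj (A $ i $ j) * y $ i))"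
    by (intro sum.cong) (auto simp: inner_complex_def algebra_simps)
  also have "\<dots> = x \<bullet> (conj_transpose A *v y)"
    by (simp add: inner_vec_def matrix_vector_mult_def inner_sum_right conj_transpose_def)
  finally show ?thesis .
qed

lemma conj_transpose_mult: "conj_transpose (A ** B) = conj_transpose B ** conj_transpose A"
  by (simp add: conj_transpose_def vec_eq_iff matrix_matrix_mult_def mult.commute)

lemma conj_transpose_mat_1 [simp]: "conj_transpose (mat 1) = mat 1"
  by (simp add: conj_transpose_def mat_def vec_eq_iff)

lemma gram_mult:
  "conj_transpose (A ** B) ** (A ** B) = conj_transpose B ** (conj_transpose A ** A) ** B"
  by (simp add: conj_transpose_mult matrix_mul_assoc)

lemma det_conj_transpose: "det (conj_transpose A) = cnj (det A)"
proof -
  have "conj_transpose A = transpose (\<chi> i j. cnj (A $ i $ j))"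
    by (simp add: conj_transpose_def transpose_def vec_eq_iff)
  moreover have "det (\<chi> i j. cnj (A $ i $ j)) = cnj (det A)"
    by (simp add: det_def)
  ultimately show ?thesis
    by (simp add: det_transpose)
qed

text \<open>
  The real inner product on complex vectors is the real part of the Hermitian one, so a
  norm-preserving complex matrix is orthogonal over the reals, and the adjoint with respect to
  the real inner product is already the conjugate transpose.
\<close>

lemma unitary_iff_norm_preserving:
  fixes A :: "complex^'n^'n"
  shows "conj_transpose A ** A = mat 1 \<longleftrightarrow> (\<forall>x. norm (A *v x) = norm x)"
proof
  assume A: "conj_transpose A ** A = mat 1"
  have "(A *v x) \<bullet> (A *v x) = x \<bullet> x" for x
    by (simp add: inner_conj_transpose matrix_vector_mul_assoc A)
  then show "\<forall>x. norm (A *v x) = norm x"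
    by (simp add: norm_eq_sqrt_inner)
next
  assume "\<forall>x. norm (A *v x) = norm x"
  then have "orthogonal_transformation ((*v) A)"
    by (simp add: orthogonal_transformation)
  then have "x \<bullet> (conj_transpose A *v (A *v y)) = x \<bullet> y" for x y
    by (simp add: orthogonal_transformation_def flip: inner_conj_transpose)
  then have "conj_transpose A *v (A *v y) = y" for y
    using vector_eq_ldot by blast
  then show "conj_transpose A ** A = mat 1"
    by (simp add: matrix_eq matrix_vector_mul_assoc)
qed

lemma SU_iff: "A \<in> SU \<longleftrightarrow> det A = 1 \<and> (\<forall>x. norm (A *v x) = norm x)"
  by (simp add: SU_def SL_def unitary_iff_norm_preserving)

text \<open>
  If \<open>\<parallel>V x\<parallel> = \<parallel>W x\<parallel>\<close> for all \<open>x\<close>, then \<open>W V\<^sup>-\<^sup>1\<close> preserves norms and is therefore unitary. A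
  unitarizer thus matters only through the norm \<open>x \<mapsto> \<parallel>V x\<parallel>\<close>, or equally through \<open>V\<^sup>* V\<close>.
\<close>

lemma gram_eq_iff_norm_eq:
  fixes V W :: "complex^'n^'n"
  assumes V: "det V \<noteq> 0"
  shows "conj_transpose V ** V = conj_transpose W ** W \<longleftrightarrow> (\<forall>x. norm (V *v x) = norm (W *v x))"
proof
  assume eq: "conj_transpose V ** V = conj_transpose W ** W"
  have "(V *v x) \<bullet> (V *v x) = (W *v x) \<bullet> (W *v x)" for x
    by (simp add: inner_conj_transpose matrix_vector_mul_assoc eq)
  then show "\<forall>x. norm (V *v x) = norm (W *v x)"
    by (simp add: norm_eq_sqrt_inner)
next
  assume eq: "\<forall>x. norm (V *v x) = norm (W *v x)"
  define Q where "Q = W ** matrix_inv V"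
  have QV: "Q ** V = W"
    by (simp add: Q_def matrix_mul_assoc[symmetric] matrix_inv_left V)
  have "norm (Q *v x) = norm x" for x
  proof -
    have "norm (Q *v x) = norm (V *v (matrix_inv V *v x))"
      using eq by (simp add: Q_def matrix_vector_mul_assoc[symmetric])
    then show ?thesis
      by (simp add: matrix_vector_mul_assoc matrix_inv_right V)
  qed
  then have "conj_transpose Q ** Q = mat 1"
    by (simp add: unitary_iff_norm_preserving)
  then have "conj_transpose V ** (conj_transpose Q ** Q) ** V = conj_transpose V ** V"
    by simp
  then show "conj_transpose V ** V = conj_transpose W ** W"
    by (simp add: QV[symmetric] conj_transpose_mult matrix_mul_assoc)
qed

text \<open>
  Substituting \<open>y = V x\<close> pulls the Euclidean norm back to \<open>x \<mapsto> \<parallel>V x\<parallel>\<close>, and conjugation does not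
  change determinants. This turns every question about unitarizers into one about invariant norms.
\<close>

lemma conjugate_in_SU_iff:
  fixes V M :: "complex^'n^'n"
  assumes V: "V \<in> SL"
  shows "V ** M ** matrix_inv V \<in> SU \<longleftrightarrow>
    M \<in> SL \<and> (\<forall>x. norm (V *v (M *v x)) = norm (V *v x))"
proof -
  have V0: "det V \<noteq> 0" and V1: "det V = 1"
    using V by (auto simp: SL_def)
  have "det (V ** matrix_inv V) = 1"
    by (simp add: matrix_inv_right V0)
  then have "det (V ** M ** matrix_inv V) = det M"
    by (simp add: det_mul V1)
  moreover have "(\<forall>y. norm ((V ** M ** matrix_inv V) *v y) = norm y) \<longleftrightarrow>
      (\<forall>x. norm (V *v (M *v x)) = norm (V *v x))" (is "?L \<longleftrightarrow> ?R")
  proof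
    assume ?L
    show ?R
    proof
      fix x
      show "norm (V *v (M *v x)) = norm (V *v x)"
        using \<open>?L\<close>[rule_format, of "V *v x"]
        by (simp add: matrix_vector_mul_assoc matrix_mul_assoc[symmetric] matrix_inv_left V0)
    qed
  next
    assume ?R
    show ?L
    proof
      fix y
      have "norm ((V ** M ** matrix_inv V) *v y) = norm (V *v (matrix_inv V *v y))"
        using \<open>?R\<close>[rule_format, of "matrix_inv V *v y"] by (simp add: matrix_vector_mul_assoc[symmetric])
      then show "norm ((V ** M ** matrix_inv V) *v y) = norm y"
        by (simp add: matrix_vector_mul_assoc matrix_inv_right V0)
    qed
  qed
  ultimately show ?thesis
    by (simp add: SU_iff SL_def)
qed

lemma norm_vector_scalar_mult: "norm (c *s x) = cmod c * norm (x :: complex^'n)"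
  by (simp add: norm_vec_def L2_set_def norm_mult power_mult_distrib sum_distrib_left[symmetric] real_sqrt_mult)

text \<open>
  The extremal vectors of the ratio \<open>\<parallel>W x\<parallel> / \<parallel>V x\<parallel>\<close> are the zeros of the form
  \<open>x \<mapsto> c\<^sup>2 \<parallel>V x\<parallel>\<^sup>2 - \<parallel>W x\<parallel>\<^sup>2\<close>, which is nonnegative when \<open>c\<close> is the maximal ratio. The zeros of a
  nonnegative quadratic form form a subspace (parallelogram law), and this one is invariant under
  every matrix that preserves both norms. Irreducibility therefore forces the ratio to be constant,
  and the determinants fix the constant. This is Schur's lemma for the Hermitian forms \<open>V\<^sup>* V\<close> and
  \<open>W\<^sup>* W\<close>, with the maximum over the unit sphere in place of an eigenvalue.
\<close>

lemma invariant_norm_unique: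
  fixes V W A B :: "complex^'n^'n"
  assumes V: "V \<in> SL" and W: "W \<in> SL" and irr: "\<not> reducible_pair A B"
    and VA: "\<And>x. norm (V *v (A *v x)) = norm (V *v x)"
    and VB: "\<And>x. norm (V *v (B *v x)) = norm (V *v x)"
    and WA: "\<And>x. norm (W *v (A *v x)) = norm (W *v x)"
    and WB: "\<And>x. norm (W *v (B *v x)) = norm (W *v x)"
  shows "norm (V *v x) = norm (W *v x)"
proof -
  have V0: "det V \<noteq> 0"
    using V by (simp add: SL_def)
  \<comment> \<open>Substituting \<open>y = V x\<close> moves the maximization to the Euclidean unit sphere, which is compact.\<close>
  define Q where "Q = W ** matrix_inv V"
  have QV: "Q *v (V *v x) = W *v x" for x
    by (simp add: Q_def matrix_vector_mul_assoc matrix_mul_assoc[symmetric] matrix_inv_left V0)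
  have "compact (sphere (0 :: complex^'n) 1)" and "sphere (0 :: complex^'n) 1 \<noteq> {}"
    by simp_all
  moreover have "continuous_on (sphere 0 1) (\<lambda>y. norm (Q *v y))"
    by (intro continuous_intros linear_continuous_on matrix_vector_mul_bounded_linear)
  ultimately obtain u where u: "norm u = 1"
    and max: "\<And>y. norm y = 1 \<Longrightarrow> norm (Q *v y) \<le> norm (Q *v u)"
    using continuous_attains_sup[of "sphere 0 1" "\<lambda>y. norm (Q *v y)"] by auto
  define c where "c = norm (Q *v u)"
  have Qle: "norm (Q *v y) \<le> c * norm y" for y
  proof (cases "y = 0")
    case False
    then have "norm (Q *v ((1 / norm y) *\<^sub>R y)) \<le> c"
      unfolding c_def by (intro max) simp
    then have "norm (Q *v y) / norm y \<le> c"
      by (simp add: linear_cmul[OF matrix_vector_mul_linear] divide_inverse mult.commute)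
    then show ?thesis
      using False by (simp add: field_simps)
  qed simp
  have Wle: "norm (W *v x) \<le> c * norm (V *v x)" for x
    using Qle[of "V *v x"] by (simp add: QV)
  define q where "q x = (c * norm (V *v x))\<^sup>2 - (norm (W *v x))\<^sup>2" for x
  have q_nonneg: "q x \<ge> 0" for x
    using Wle[of x] by (simp add: q_def power_mono)
  define Z where "Z = {x. q x = 0}"
  have parallelogram: "q (x + y) + q (x - y) = 2 * q x + 2 * q y" for x y
    by (simp add: q_def power_mult_distrib matrix_vector_mult_add_rdistrib matrix_vector_right_distrib
        matrix_vector_mult_diff_distrib power2_norm_eq_inner inner_add inner_diff algebra_simps inner_commute)
  have "vec.subspace Z"
    unfolding vec.subspace_def Z_def
  proof (intro conjI allI ballI; simp)
    show "q 0 = 0"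
      by (simp add: q_def)
  next
    fix x y assume "q x = 0" and "q y = 0"
    then show "q (x + y) = 0"
      using parallelogram[of x y] q_nonneg[of "x + y"] q_nonneg[of "x - y"] by linarith
  next
    fix a x assume x: "q x = 0"
    have "q (a *s x) = (cmod a)\<^sup>2 * q x"
      by (simp add: q_def vec.scale norm_vector_scalar_mult power_mult_distrib algebra_simps)
    then show "q (a *s x) = 0"
      using x by simp
  qed
  moreover have "Z \<noteq> {0}"
  proof -
    have "V *v (matrix_inv V *v u) = u"
      by (simp add: matrix_vector_mul_assoc matrix_inv_right V0)
    then have "matrix_inv V *v u \<in> Z" and "matrix_inv V *v u \<noteq> 0"
      using u by (auto simp: Z_def q_def c_def simp flip: QV)
    then show ?thesis
      by blast
  qed
  moreover have "\<forall>z\<in>Z. A *v z \<in> Z" and "\<forall>z\<in>Z. B *v z \<in> Z"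
    by (simp_all add: Z_def q_def VA VB WA WB)
  ultimately have "Z = UNIV"
    using irr unfolding reducible_pair_def by blast
  then have q0: "(norm (W *v x))\<^sup>2 = (c * norm (V *v x))\<^sup>2" for x
    using UNIV_I[of x] unfolding \<open>Z = UNIV\<close>[symmetric] by (simp add: Z_def q_def)
  have "c \<ge> 0"
    by (simp add: c_def)
  with q0 have Wc: "norm (W *v x) = c * norm (V *v x)" for x
    by (meson mult_nonneg_nonneg norm_ge_zero power2_eq_imp_eq)
  \<comment> \<open>\<open>W\<close> and \<open>c V\<close> induce the same norm, so \<open>1 = \<bar>det W\<bar> = c\<^sup>n \<bar>det V\<bar> = c\<^sup>n\<close>.\<close>
  define D where "D = mat (of_real c) ** V"
  have "mat a *v y = a *s y" for a and y :: "complex^'n"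
    by (simp add: vec_eq_iff matrix_vector_mult_def mat_def if_distrib[of "\<lambda>z. z * _"] cong: if_cong)
  then have Dx: "D *v x = of_real c *s (V *v x)" for x
    by (simp add: D_def flip: matrix_vector_mul_assoc)
  have "norm (W *v x) = norm (D *v x)" for x
    by (simp add: Dx norm_vector_scalar_mult Wc \<open>c \<ge> 0\<close>)
  then have "conj_transpose W ** W = conj_transpose D ** D"
    using W by (subst gram_eq_iff_norm_eq) (simp_all add: SL_def)
  then have "det (conj_transpose W ** W) = det (conj_transpose D ** D)"
    by simp
  moreover have "det D = of_real c ^ CARD('n)"
    using V by (simp add: D_def det_mul SL_def mat_def det_diagonal)
  ultimately have "complex_of_real (c ^ (2 * CARD('n))) = 1"
    using W by (simp add: det_mul det_conj_transpose SL_def mult_2 power_add)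
  then have "c ^ (2 * CARD('n)) = 1"
    unfolding of_real_eq_1_iff .
  then have "c = 1"
    using \<open>c \<ge> 0\<close> power_eq_iff_eq_base[of "2 * CARD('n)" c 1] by simp
  then show ?thesis
    using Wc by simp
qed

section \<open>Analytic Cholesky factorization\<close>

text \<open>
  These are the positive definite Hermitian matrices. Presenting them as Gram matrices makes their
  invariance under congruence by invertible matrices immediate.
\<close>

definition gram_matrices :: "(complex^'n^'n) set"
  where "gram_matrices = {conj_transpose B ** B |B. det B \<noteq> 0}"

lemma gram_matrix_diagonal_pos:
  assumes "K \<in> gram_matrices"
  shows "\<exists>d>0. K $ i $ i = complex_of_real d"
proof -
  obtain B where B: "det B \<noteq> 0" and K: "K = conj_transpose B ** B"
    using assms by (auto simp: gram_matrices_def)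
  have K_ii: "K $ i $ i = complex_of_real (\<Sum>k\<in>UNIV. (cmod (B $ k $ i))\<^sup>2)"
    by (simp add: K matrix_matrix_mult_def conj_transpose_def complex_norm_square mult.commute del: of_real_power)
  moreover have "(\<Sum>k\<in>UNIV. (cmod (B $ k $ i))\<^sup>2) \<noteq> 0"
  proof
    assume "(\<Sum>k\<in>UNIV. (cmod (B $ k $ i))\<^sup>2) = 0"
    then have "column i B = 0"
      by (simp add: sum_nonneg_eq_0_iff column_def vec_eq_iff)
    then show False
      using B det_zero_column(1)[of i B] by simp
  qed
  ultimately show ?thesis
    by (metis order_le_less sum_nonneg zero_le_power2)
qed

lemma gram_matrix_hermitian:
  assumes "K \<in> gram_matrices"
  shows "cnj (K $ i $ j) = K $ j $ i"
  using assms by (auto simp: gram_matrices_def matrix_matrix_mult_def conj_transpose_def mult.commute)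

text \<open>
  One step of symmetric Gaussian elimination: subtracting multiples of the basis vector \<open>e\<^sub>i\<close>
  from the others makes them orthogonal to \<open>e\<^sub>i\<close> for the form \<open>K\<close>. The two matrices carry out
  this change of basis and its inverse.
\<close>

definition eliminate :: "'n \<Rightarrow> complex^'n^'n \<Rightarrow> complex^'n^'n"
  where "eliminate i K = (\<chi> a b. (if a = b then 1 else 0) -
    (if a = i then (if b = i then 0 else K $ i $ b / K $ i $ i) else 0))"

definition restore :: "'n \<Rightarrow> complex^'n^'n \<Rightarrow> complex^'n^'n"
  where "restore i K = (\<chi> a b. (if a = b then 1 else 0) +
    (if a = i then (if b = i then 0 else K $ i $ b / K $ i $ i) else 0))"

lemma eliminate_restore: "eliminate i K ** restore i K = mat 1"
proof -
  have "(\<Sum>c\<in>UNIV. eliminate i K $ a $ c * restore i K $ c $ b) = (if a = b then 1 else 0)" for a b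
  proof -
    let ?m = "\<lambda>b. if b = i then 0 else K $ i $ b / K $ i $ i"
    have "eliminate i K $ a $ c * restore i K $ c $ b =
        (if c = a then restore i K $ a $ b else 0) -
        (if c = b then (if a = i then ?m b else 0) else 0)" for c
      by (simp add: eliminate_def restore_def)
    then have "(\<Sum>c\<in>UNIV. eliminate i K $ a $ c * restore i K $ c $ b) =
        restore i K $ a $ b - (if a = i then ?m b else 0)"
      by (simp add: sum_subtractf)
    then show ?thesis
      by (simp add: restore_def)
  qed
  then show ?thesis
    by (simp add: vec_eq_iff matrix_matrix_mult_def mat_def)
qed

lemma matrix_mult_eliminate:
  "(K ** eliminate i L) $ a $ b =
    K $ a $ b - (if b = i then 0 else K $ a $ i * (L $ i $ b / L $ i $ i))"
proof -
  have "(K ** eliminate i L) $ a $ b = (\<Sum>c\<in>UNIV. (if c = b then K $ a $ b else 0) -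
      (if c = i then K $ a $ i * (if b = i then 0 else L $ i $ b / L $ i $ i) else 0))"
    unfolding matrix_matrix_mult_def eliminate_def by (auto intro!: sum.cong simp: algebra_simps)
  then show ?thesis
    by (simp add: sum_subtractf)
qed

text \<open>
  For \<open>a \<noteq> b\<close> the right-hand side vanishes if one index is \<open>i\<close>, and equals \<open>K $ a $ b\<close> if
  the row and column of \<open>a\<close> or of \<open>b\<close> were cleared before: a step clears row and column
  \<open>i\<close> and destroys no earlier zero.
\<close>

lemma eliminate_congruence_entry:
  assumes K: "K \<in> gram_matrices"
  shows "(conj_transpose (eliminate i K) ** K ** eliminate i K) $ a $ b =
    (if a = i \<and> b = i then K $ i $ i
     else K $ a $ b - K $ a $ i * K $ i $ b / K $ i $ i)"
proof -
  define E where "E = eliminate i K"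
  have K_herm: "conj_transpose K = K"
    using gram_matrix_hermitian[OF K] by (simp add: conj_transpose_def vec_eq_iff)
  have K_ii: "K $ i $ i \<noteq> 0"
    using gram_matrix_diagonal_pos[OF K, of i] by auto
  have KE: "(K ** E) $ a $ b = (if b = i then K $ a $ i else K $ a $ b - K $ a $ i * K $ i $ b / K $ i $ i)" for a b
    by (simp add: E_def matrix_mult_eliminate)
  have "conj_transpose E ** K = conj_transpose (K ** E)"
    by (simp add: conj_transpose_mult K_herm)
  then have EK: "(conj_transpose E ** K) $ a $ b = cnj ((K ** E) $ b $ a)" for a b
    by (simp add: conj_transpose_def)
  have "(conj_transpose E ** K ** E) $ a $ b =
      (if b = i then cnj ((K ** E) $ i $ a) else cnj ((K ** E) $ b $ a) - cnj ((K ** E) $ i $ a) * (K $ i $ b / K $ i $ i))"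
    using matrix_mult_eliminate[of "conj_transpose E ** K" i K a b, folded E_def] by (simp add: EK)
  then show ?thesis
    using K_ii by (auto simp: KE gram_matrix_hermitian[OF K] mult.commute simp flip: E_def)
qed

text \<open>
  Induction over the set of indices whose rows and columns are already cleared. The pivots stay
  positive because congruence preserves positive definiteness. The factors are
  rational functions of the entries of \<open>H\<close> and their conjugates without poles on
  \<open>gram_matrices\<close>, hence analytic whenever \<open>H\<close> is. They are functions of the matrix \<open>H\<close> alone:
  on a curve they are globally defined as soon as \<open>H\<close> is, and nothing has to be glued.
\<close>

lemma analytic_congruence_diagonalization:
  fixes I :: "'n::finite set"
  assumes "finite I"
  shows "\<exists>R K :: complex^'n^'n \<Rightarrow> complex^'n^'n.
    (\<forall>H\<in>gram_matrices. det (R H) \<noteq> 0 \<and> K H \<in> gram_matrices \<and>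
       H = conj_transpose (R H) ** K H ** R H \<and>
       (\<forall>a b. a \<noteq> b \<longrightarrow> a \<in> I \<or> b \<in> I \<longrightarrow> K H $ a $ b = 0)) \<and>
    (\<forall>f S. real_analytic_on f S \<longrightarrow> f ` S \<subseteq> gram_matrices \<longrightarrow>
       real_analytic_on (\<lambda>x. R (f x)) S \<and> real_analytic_on (\<lambda>x. K (f x)) S)"
  using assms
proof (induction I rule: finite_induct)
  case empty
  show ?case
    by (intro exI[of _ "\<lambda>_. mat 1"] exI[of _ "\<lambda>H. H"])
      (auto simp: real_analytic_on_matrix real_analytic_on_const)
next
  case (insert i I)
  obtain R K :: "complex^'n^'n \<Rightarrow> complex^'n^'n" where
    RK_all: "\<forall>H\<in>gram_matrices. det (R H) \<noteq> 0 \<and> K H \<in> gram_matrices \<and>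
       H = conj_transpose (R H) ** K H ** R H \<and>
       (\<forall>a b. a \<noteq> b \<longrightarrow> a \<in> I \<or> b \<in> I \<longrightarrow> K H $ a $ b = 0)" and
    RK_analytic_all: "\<forall>f S. real_analytic_on f S \<longrightarrow> f ` S \<subseteq> gram_matrices \<longrightarrow>
       real_analytic_on (\<lambda>x. R (f x)) S \<and> real_analytic_on (\<lambda>x. K (f x)) S"
    using insert.IH by (elim exE conjE) (rule that)
  note RK = RK_all[THEN bspec] and RK_analytic = RK_analytic_all[THEN spec, THEN spec, THEN mp, THEN mp]
  define E where "E H = eliminate i (K H)" for H
  define F where "F H = restore i (K H)" for H
  define R' where "R' H = F H ** R H" for H
  define K' where "K' H = conj_transpose (E H) ** K H ** E H" for H
  have EF: "E H ** F H = mat 1" for H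
    by (simp add: E_def F_def eliminate_restore)
  have det_EF: "det (E H) \<noteq> 0 \<and> det (F H) \<noteq> 0" for H
    by (metis EF det_I det_mul mult_eq_0_iff zero_neq_one)
  have factors: "det (R' H) \<noteq> 0 \<and> K' H \<in> gram_matrices \<and> H = conj_transpose (R' H) ** K' H ** R' H \<and>
       (\<forall>a b. a \<noteq> b \<longrightarrow> a \<in> insert i I \<or> b \<in> insert i I \<longrightarrow> K' H $ a $ b = 0)"
    if H: "H \<in> gram_matrices" for H
  proof (intro conjI allI impI)
    have K: "K H \<in> gram_matrices"
      using RK[OF H] by blast
    show "det (R' H) \<noteq> 0"
      using RK[OF H] det_EF by (simp add: R'_def det_mul)
    obtain B where B: "det B \<noteq> 0" "K H = conj_transpose B ** B"
      using K by (auto simp: gram_matrices_def)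
    have "K' H = conj_transpose (B ** E H) ** (B ** E H)"
      by (simp add: K'_def B conj_transpose_mult matrix_mul_assoc)
    moreover have "det (B ** E H) \<noteq> 0"
      using B det_EF by (simp add: det_mul)
    ultimately show "K' H \<in> gram_matrices"
      unfolding gram_matrices_def by blast
    have FE: "conj_transpose (F H) ** conj_transpose (E H) = mat 1"
      by (simp add: EF flip: conj_transpose_mult)
    have "conj_transpose (R' H) ** K' H ** R' H =
        conj_transpose (R H) ** (conj_transpose (F H) ** conj_transpose (E H)) ** K H ** (E H ** F H) ** R H"
      by (simp only: R'_def K'_def conj_transpose_mult matrix_mul_assoc)
    also have "\<dots> = H"
      using RK[OF H] by (simp add: FE EF)
    finally show "H = conj_transpose (R' H) ** K' H ** R' H" ..
    fix a b
    assume ab: "a \<noteq> b" "a \<in> insert i I \<or> b \<in> insert i I"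
    have K_ii: "K H $ i $ i \<noteq> 0"
      using gram_matrix_diagonal_pos[OF K, of i] by auto
    have K_0: "K H $ c $ d = 0" if "c \<noteq> d" "c \<in> I \<or> d \<in> I" for c d
      using RK[OF H] that by blast
    have "K' H $ a $ b = K H $ a $ b - K H $ a $ i * K H $ i $ b / K H $ i $ i"
      using ab by (auto simp: K'_def E_def eliminate_congruence_entry[OF K])
    also have "\<dots> = 0"
    proof (cases "a = i \<or> b = i")
      case True
      then show ?thesis
        using K_ii by auto
    next
      case False
      then have "K H $ a $ b = 0" and "K H $ a $ i = 0 \<or> K H $ i $ b = 0"
        using ab K_0[of a b] K_0[of a i] K_0[of i b] by auto
      then show ?thesis
        by auto
    qed
    finally show "K' H $ a $ b = 0" .
  qed
  have analytic: "real_analytic_on (\<lambda>x. R' (f x)) S \<and> real_analytic_on (\<lambda>x. K' (f x)) S"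
    if f: "real_analytic_on f S" "f ` S \<subseteq> gram_matrices" for f S
  proof -
    have R: "real_analytic_on (\<lambda>x. R (f x)) S" and K: "real_analytic_on (\<lambda>x. K (f x)) S"
      using RK_analytic[OF f] by auto
    have K_ab: "real_analytic_on (\<lambda>x. K (f x) $ a $ b) S" for a b
      using K by (simp add: real_analytic_on_matrix)
    have "K (f x) $ i $ i \<noteq> 0" if "x \<in> S" for x
      using gram_matrix_diagonal_pos[of "K (f x)" i] RK[of "f x"] f(2) that by fastforce
    then have multiplier: "real_analytic_on (\<lambda>x. K (f x) $ i $ b / K (f x) $ i $ i) S" for b
      by (intro real_analytic_on_divide K_ab)
    have "real_analytic_on (\<lambda>x. E (f x)) S"
      unfolding E_def eliminate_def real_analytic_on_matrix
      by (simp only: vec_lambda_beta)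
        (intro allI real_analytic_on_diff real_analytic_on_if real_analytic_on_const multiplier)
    moreover have "real_analytic_on (\<lambda>x. F (f x)) S"
      unfolding F_def restore_def real_analytic_on_matrix
      by (simp only: vec_lambda_beta)
        (intro allI real_analytic_on_add real_analytic_on_if real_analytic_on_const multiplier)
    ultimately show ?thesis
      unfolding R'_def K'_def
      by (simp add: R K real_analytic_on_matrix_mult real_analytic_on_conj_transpose)
  qed
  show ?case
    by (rule exI[of _ R'], rule exI[of _ K'], rule conjI, rule ballI, rule factors, assumption)
      (intro allI impI, rule analytic)
qed

text \<open>
  The square root of the diagonal part turns the diagonalization into \<open>H = L\<^sup>* L\<close>. If
  \<open>det H = 1\<close>, then \<open>det L\<close> has modulus 1, and dividing one row of \<open>L\<close> by it gives a matrix \<open>C\<close> in \<open>SL\<close> with the same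
  Gram matrix.
\<close>

theorem analytic_cholesky:
  "\<exists>C :: complex^'n^'n \<Rightarrow> complex^'n^'n.
    (\<forall>H\<in>gram_matrices. det H = 1 \<longrightarrow> C H \<in> SL \<and> conj_transpose (C H) ** C H = H) \<and>
    (\<forall>f S. real_analytic_on f S \<longrightarrow> f ` S \<subseteq> gram_matrices \<longrightarrow> real_analytic_on (\<lambda>x. C (f x)) S)"
proof -
  obtain R K :: "complex^'n^'n \<Rightarrow> complex^'n^'n" where
    RK_all: "\<forall>H\<in>gram_matrices. det (R H) \<noteq> 0 \<and> K H \<in> gram_matrices \<and>
       H = conj_transpose (R H) ** K H ** R H \<and> (\<forall>a b. a \<noteq> b \<longrightarrow> K H $ a $ b = 0)" and
    RK_analytic_all: "\<forall>f S. real_analytic_on f S \<longrightarrow> f ` S \<subseteq> gram_matrices \<longrightarrow>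
       real_analytic_on (\<lambda>x. R (f x)) S \<and> real_analytic_on (\<lambda>x. K (f x)) S"
    using analytic_congruence_diagonalization[OF finite[of "UNIV :: 'n set"], simplified UNIV_I simp_thms]
    by (elim exE conjE) (rule that)
  note RK = RK_all[THEN bspec] and RK_analytic = RK_analytic_all[THEN spec, THEN spec, THEN mp, THEN mp]
  define diag :: "('n \<Rightarrow> complex) \<Rightarrow> complex^'n^'n" where "diag d = (\<chi> a b. if a = b then d a else 0)" for d
  have diag_analytic: "real_analytic_on (\<lambda>x. diag (\<lambda>a. d a x)) S"
    if "\<And>a. real_analytic_on (d a) S" for d S
    unfolding diag_def real_analytic_on_matrix
    using that by (simp add: real_analytic_on_if real_analytic_on_const)
  have diag_square: "conj_transpose (diag d) ** diag d = diag (\<lambda>a. cnj (d a) * d a)" for d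
    by (simp add: diag_def conj_transpose_def vec_eq_iff matrix_matrix_mult_def if_distrib[of cnj]
        if_distrib[of "\<lambda>z. z * _"] cong: if_cong)
  have det_diag: "det (diag d) = (\<Prod>a\<in>UNIV. d a)" for d
    by (simp add: diag_def det_diagonal)
  obtain i0 :: 'n where True
    by blast
  define L where "L H = diag (\<lambda>a. csqrt (K H $ a $ a)) ** R H" for H
  define phase where "phase H = diag (\<lambda>a. if a = i0 then 1 / det (L H) else 1)" for H
  define C where "C H = phase H ** L H" for H
  have L: "det (L H) \<noteq> 0 \<and> conj_transpose (L H) ** L H = H" if H: "H \<in> gram_matrices" for H
  proof
    have K: "\<exists>d>0. K H $ a $ a = complex_of_real d" for a
      using RK[OF H] gram_matrix_diagonal_pos by blast
    then have "K H $ a $ a \<noteq> 0" for a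
      by (metis less_irrefl of_real_eq_0_iff)
    then show "det (L H) \<noteq> 0"
      using RK[OF H] by (simp add: L_def det_mul det_diag)
    have "cnj (csqrt (K H $ a $ a)) * csqrt (K H $ a $ a) = K H $ a $ a" for a
    proof -
      obtain d where d: "d > 0" "K H $ a $ a = complex_of_real d"
        using K by blast
      then have "csqrt (K H $ a $ a) = complex_of_real (sqrt d)"
        by simp
      then show ?thesis
        using d by (simp flip: of_real_mult)
    qed
    then have "conj_transpose (diag (\<lambda>a. csqrt (K H $ a $ a))) ** diag (\<lambda>a. csqrt (K H $ a $ a)) = K H"
      unfolding diag_square using RK[OF H] by (simp add: diag_def vec_eq_iff)
    then have "conj_transpose (L H) ** L H = conj_transpose (R H) ** K H ** R H"
      by (simp add: L_def gram_mult)
    then show "conj_transpose (L H) ** L H = H"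
      using RK[OF H] by simp
  qed
  have factor: "C H \<in> SL \<and> conj_transpose (C H) ** C H = H" if H: "H \<in> gram_matrices" and "det H = 1" for H
  proof
    have "cnj (det (L H)) * det (L H) = 1"
      using L[OF H] \<open>det H = 1\<close> by (metis det_conj_transpose det_mul)
    then have "conj_transpose (phase H) ** phase H = mat 1"
      unfolding phase_def diag_square
      by (auto simp: diag_def mat_def vec_eq_iff)
    then show "conj_transpose (C H) ** C H = H"
      using L[OF H] by (simp add: C_def gram_mult)
    show "C H \<in> SL"
      using L[OF H] by (simp add: SL_def C_def phase_def det_mul det_diag)
  qed
  have analytic: "real_analytic_on (\<lambda>x. C (f x)) S"
    if f: "real_analytic_on f S" "f ` S \<subseteq> gram_matrices" for f S
  proof -
    have R: "real_analytic_on (\<lambda>x. R (f x)) S" and K: "real_analytic_on (\<lambda>x. K (f x)) S"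
      using RK_analytic[OF f] by auto
    have "real_analytic_on (\<lambda>x. csqrt (K (f x) $ a $ a)) S" for a
    proof (rule real_analytic_on_csqrt)
      show "real_analytic_on (\<lambda>x. K (f x) $ a $ a) S"
        using K by (simp add: real_analytic_on_matrix)
      fix x assume "x \<in> S"
      then have "K (f x) \<in> gram_matrices"
        using f(2) RK by blast
      then show "K (f x) $ a $ a \<notin> \<real>\<^sub>\<le>\<^sub>0"
        using gram_matrix_diagonal_pos[of "K (f x)" a] by auto
    qed
    then have L_analytic: "real_analytic_on (\<lambda>x. L (f x)) S"
      unfolding L_def by (intro real_analytic_on_matrix_mult diag_analytic R)
    have "det (L (f x)) \<noteq> 0" if "x \<in> S" for x
      using L f(2) that by blast
    then have inv_det: "real_analytic_on (\<lambda>x. 1 / det (L (f x))) S"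
      by (intro real_analytic_on_divide real_analytic_on_const real_analytic_on_det L_analytic)
    have "real_analytic_on (\<lambda>x. phase (f x)) S"
      unfolding phase_def
    proof (rule diag_analytic)
      show "real_analytic_on (\<lambda>x. if a = i0 then 1 / det (L (f x)) else 1) S" for a
        using inv_det by (cases "a = i0") (simp_all add: real_analytic_on_const)
    qed
    then show ?thesis
      unfolding C_def by (intro real_analytic_on_matrix_mult L_analytic)
  qed
  show ?thesis
    by (rule exI[of _ C], rule conjI, intro ballI impI, rule factor)
      (assumption, assumption, intro allI impI, rule analytic)
qed

section \<open>Unitarizers on a curve\<close>

lemma analytic_map_onD:
  assumes "analytic_map_on \<A> D f" and "(U, \<phi>) \<in> \<A>"
  shows "real_analytic_on (\<lambda>x. f (inv_into U \<phi> x)) (\<phi> ` (U \<inter> D))"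
  using assms by (auto simp: analytic_map_on_def o_def)

lemma analytic_map_onI:
  assumes "\<And>U \<phi>. (U, \<phi>) \<in> \<A> \<Longrightarrow> real_analytic_on (\<lambda>x. f (inv_into U \<phi> x)) (\<phi> ` (U \<inter> D))"
  shows "analytic_map_on \<A> D f"
  using assms by (auto simp: analytic_map_on_def o_def)

lemma is_chart_inj_on:
  assumes "is_chart X U \<phi>"
  shows "inj_on \<phi> U"
  using assms openin_subset[of X U] unfolding is_chart_def homeomorphic_map_def quotient_map_def
  by (auto simp: topspace_subtopology Int_absorb1 homeomorphic_map_def dest: homeomorphic_imp_injective_map)

lemma is_chart_open_image:
  assumes chart: "is_chart X U \<phi>" and D: "openin X D"
  shows "open (\<phi> ` (U \<inter> D))"
proof -
  have "openin (subtopology X U) (U \<inter> D)"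
    using D by (auto simp: openin_subtopology Int_commute)
  moreover have "open_map (subtopology X U) (top_of_set (\<phi> ` U)) \<phi>"
    using chart homeomorphic_imp_open_map unfolding is_chart_def by blast
  ultimately have "openin (top_of_set (\<phi> ` U)) (\<phi> ` (U \<inter> D))"
    unfolding open_map_def by blast
  then show ?thesis
    using chart openin_open_trans unfolding is_chart_def by blast
qed

lemma analytic_curve_chart:
  assumes "analytic_curve X \<A>" and "(U, \<phi>) \<in> \<A>"
  shows "is_chart X U \<phi>"
  using assms by (auto simp: analytic_curve_def analytic_atlas_def)

lemma analytic_curve_ex_chart:
  assumes "analytic_curve X \<A>" and "p \<in> topspace X"
  obtains U \<phi> where "(U, \<phi>) \<in> \<A>" and "p \<in> U"
  using assms unfolding analytic_curve_def analytic_atlas_def by blast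

text \<open>
  Analyticity is tested in each chart separately, so it passes from the pieces \<open>E\<close> to their union
  within a single chart, without changing coordinates.
\<close>

lemma analytic_map_on_eq_nhd:
  assumes curve: "analytic_curve X \<A>"
    and loc: "\<And>p. p \<in> D \<Longrightarrow> \<exists>E g. openin X E \<and> p \<in> E \<and> analytic_map_on \<A> E g \<and> (\<forall>r\<in>E. f r = g r)"
  shows "analytic_map_on \<A> D f"
proof (rule analytic_map_onI, subst real_analytic_on_pointwise, rule ballI)
  fix U \<phi> x assume chart: "(U, \<phi>) \<in> \<A>" and "x \<in> \<phi> ` (U \<inter> D)"
  then obtain p where p: "p \<in> U" "p \<in> D" "x = \<phi> p"
    by blast
  obtain E g where E: "openin X E" "p \<in> E" and g: "analytic_map_on \<A> E g" "\<forall>r\<in>E. f r = g r"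
    using loc[OF \<open>p \<in> D\<close>] by blast
  have \<phi>: "is_chart X U \<phi>"
    using analytic_curve_chart[OF curve chart] .
  show "real_analytic_on (\<lambda>x. f (inv_into U \<phi> x)) {x}"
  proof (rule real_analytic_on_cong_nhd)
    show "real_analytic_on (\<lambda>x. g (inv_into U \<phi> x)) (\<phi> ` (U \<inter> E))"
      using analytic_map_onD[OF g(1) chart] .
    show "open (\<phi> ` (U \<inter> E))"
      using is_chart_open_image[OF \<phi> E(1)] .
    show "x \<in> \<phi> ` (U \<inter> E)" and "x \<in> \<phi> ` (U \<inter> E)"
      using p E by auto
    show "f (inv_into U \<phi> y) = g (inv_into U \<phi> y)" if "y \<in> \<phi> ` (U \<inter> E)" for y
      using that g(2) inv_into_f_f[OF is_chart_inj_on[OF \<phi>]] by fastforce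
  qed
qed

text \<open>
  A chart maps a neighbourhood of \<open>p\<close> onto an open set of reals, so \<open>p\<close> is a limit of other points
  of the neighbourhood, and continuity alone determines the value at \<open>p\<close>.
\<close>

lemma analytic_maps_eq_at_isolated_point:
  fixes f g :: "'c \<Rightarrow> complex^'n^'m"
  assumes curve: "analytic_curve X \<A>"
    and D: "openin X D" and f: "analytic_map_on \<A> D f" and g: "analytic_map_on \<A> D g"
    and p: "p \<in> D" and T: "openin X T" "p \<in> T"
    and eq: "\<And>r. r \<in> D \<inter> T - {p} \<Longrightarrow> f r = g r"
  shows "f p = g p"
proof -
  have "p \<in> topspace X"
    using D p openin_subset by blast
  then obtain U \<phi> where chart: "(U, \<phi>) \<in> \<A>" and "p \<in> U"
    using analytic_curve_ex_chart[OF curve] by blast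
  have \<phi>: "is_chart X U \<phi>"
    using analytic_curve_chart[OF curve chart] .
  have inv: "inv_into U \<phi> (\<phi> r) = r" if "r \<in> U" for r
    using inv_into_f_f[OF is_chart_inj_on[OF \<phi>] that] .
  have "f (inv_into U \<phi> (\<phi> p)) $ i $ j = g (inv_into U \<phi> (\<phi> p)) $ i $ j" for i j
  proof (rule real_analytic_on_eq_at_limit)
    show "real_analytic_on (\<lambda>x. f (inv_into U \<phi> x) $ i $ j) (\<phi> ` (U \<inter> D))"
      using analytic_map_onD[OF f chart] by (simp add: real_analytic_on_matrix)
    show "real_analytic_on (\<lambda>x. g (inv_into U \<phi> x) $ i $ j) (\<phi> ` (U \<inter> D))"
      using analytic_map_onD[OF g chart] by (simp add: real_analytic_on_matrix)
    show "\<phi> p \<in> \<phi> ` (U \<inter> D)" and "\<phi> p \<in> \<phi> ` (U \<inter> (D \<inter> T))"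
      using p \<open>p \<in> U\<close> \<open>p \<in> T\<close> by auto
    show "open (\<phi> ` (U \<inter> (D \<inter> T)))"
      using is_chart_open_image[OF \<phi> openin_Int[OF D T(1)]] .
    fix y assume "y \<in> \<phi> ` (U \<inter> (D \<inter> T))" and "y \<noteq> \<phi> p"
    then obtain r where r: "r \<in> U" "r \<in> D \<inter> T - {p}" "y = \<phi> r"
      by blast
    then show "f (inv_into U \<phi> y) $ i $ j = g (inv_into U \<phi> y) $ i $ j"
      using eq[of r] by (simp add: inv)
  qed
  then show ?thesis
    by (simp add: inv \<open>p \<in> U\<close> vec_eq_iff)
qed

lemma analytic_map_on_subset:
  assumes "analytic_map_on \<A> D f" and "E \<subseteq> D"
  shows "analytic_map_on \<A> E f"
proof (rule analytic_map_onI, subst real_analytic_on_pointwise, rule ballI)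
  fix U \<phi> x assume chart: "(U, \<phi>) \<in> \<A>" and "x \<in> \<phi> ` (U \<inter> E)"
  then have "x \<in> \<phi> ` (U \<inter> D)"
    using \<open>E \<subseteq> D\<close> by blast
  then show "real_analytic_on (\<lambda>x. f (inv_into U \<phi> x)) {x}"
    using analytic_map_onD[OF assms(1) chart] by (subst (asm) real_analytic_on_pointwise) (rule bspec)
qed

lemma analytic_map_on_gram:
  assumes "analytic_map_on \<A> D V"
  shows "analytic_map_on \<A> D (\<lambda>p. conj_transpose (V p) ** V p)"
  using analytic_map_onD[OF assms]
  by (intro analytic_map_onI real_analytic_on_matrix_mult real_analytic_on_conj_transpose)

lemma simultaneous_unitarizerD:
  assumes "simultaneous_unitarizer \<A> D q M V"
  shows simultaneous_unitarizer_analytic: "analytic_map_on \<A> D V"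
    and simultaneous_unitarizer_SL: "p \<in> D \<Longrightarrow> V p \<in> SL"
    and simultaneous_unitarizer_norm:
      "k \<in> {1..q} \<Longrightarrow> p \<in> D \<Longrightarrow> norm (V p *v (M k p *v x)) = norm (V p *v x)"
  using assms unfolding simultaneous_unitarizer_def by (auto simp: conjugate_in_SU_iff)

text \<open>
  At irreducible points this is the uniqueness of the invariant norm. The remaining points are
  isolated, so continuity carries the equality over to them. Hence the local unitarizers, which
  themselves need not agree on overlaps, have Gram matrices that do.
\<close>

lemma simultaneous_unitarizer_gram_unique:
  fixes M :: "nat \<Rightarrow> 'c \<Rightarrow> complex^'n^'n"
  assumes curve: "analytic_curve X \<A>"
    and q: "q \<ge> 2"
    and S_isolated: "\<And>p. p \<in> S \<Longrightarrow> \<exists>T. openin X T \<and> T \<inter> S = {p}"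
    and irreducible: "\<And>p. p \<in> topspace X - S \<Longrightarrow> \<not> reducible_pair (M 1 p) (M 2 p)"
    and D: "openin X D" and E: "openin X E"
    and V: "simultaneous_unitarizer \<A> D q M V" and W: "simultaneous_unitarizer \<A> E q M W"
    and p: "p \<in> D \<inter> E"
  shows "conj_transpose (V p) ** V p = conj_transpose (W p) ** W p"
proof -
  have D_sub: "D \<subseteq> topspace X"
    using D openin_subset by auto
  note V' = simultaneous_unitarizerD[OF V] and W' = simultaneous_unitarizerD[OF W]
  have off_S: "conj_transpose (V r) ** V r = conj_transpose (W r) ** W r" if r: "r \<in> D \<inter> E" "r \<notin> S" for r
  proof -
    have irr: "\<not> reducible_pair (M 1 r) (M 2 r)"
      using irreducible r D_sub by blast
    have "norm (V r *v x) = norm (W r *v x)" for x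
      using r q by (intro invariant_norm_unique[OF _ _ irr] V' W') auto
    moreover have "det (V r) \<noteq> 0"
      using V'(2)[of r] r by (simp add: SL_def)
    ultimately show ?thesis
      by (simp add: gram_eq_iff_norm_eq)
  qed
  show ?thesis
  proof (cases "p \<in> S")
    case False
    then show ?thesis
      using off_S p by blast
  next
    case True
    then obtain T where T: "openin X T" "T \<inter> S = {p}"
      using S_isolated by blast
    show ?thesis
    proof (rule analytic_maps_eq_at_isolated_point[OF curve openin_Int[OF D E] _ _ p T(1)])
      show "analytic_map_on \<A> (D \<inter> E) (\<lambda>p. conj_transpose (V p) ** V p)"
        using V'(1) by (intro analytic_map_on_gram) (auto intro: analytic_map_on_subset)
      show "analytic_map_on \<A> (D \<inter> E) (\<lambda>p. conj_transpose (W p) ** W p)"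
        using W'(1) by (intro analytic_map_on_gram) (auto intro: analytic_map_on_subset)
      show "p \<in> T"
        using T by blast
      show "conj_transpose (V r) ** V r = conj_transpose (W r) ** W r" if "r \<in> D \<inter> E \<inter> T - {p}" for r
        using off_S that T(2) by blast
    qed
  qed
qed

lemma analytic_map_on_compose_gram:
  fixes C :: "complex^'n^'n \<Rightarrow> complex^'n^'n" and H :: "'c \<Rightarrow> complex^'n^'n"
  assumes C: "\<And>f S. real_analytic_on f S \<Longrightarrow> f ` S \<subseteq> gram_matrices \<Longrightarrow> real_analytic_on (\<lambda>x. C (f x)) S"
    and curve: "analytic_curve X \<A>"
    and H: "analytic_map_on \<A> D H" and H_gram: "\<And>p. p \<in> D \<Longrightarrow> H p \<in> gram_matrices"
  shows "analytic_map_on \<A> D (\<lambda>p. C (H p))"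
proof (rule analytic_map_onI)
  fix U \<phi> assume chart: "(U, \<phi>) \<in> \<A>"
  have "(\<lambda>x. H (inv_into U \<phi> x)) ` \<phi> ` (U \<inter> D) \<subseteq> gram_matrices"
    using H_gram inv_into_f_f[OF is_chart_inj_on[OF analytic_curve_chart[OF curve chart]]] by auto
  then show "real_analytic_on (\<lambda>x. C (H (inv_into U \<phi> x))) (\<phi> ` (U \<inter> D))"
    using C analytic_map_onD[OF H chart] by blast
qed

theorem theorem1p10:
  fixes X :: "'c topology" and \<A> :: "'c chart set"
    and q :: nat and M :: "nat \<Rightarrow> 'c \<Rightarrow> complex^'n^'n" and S :: "'c set"
  assumes curve: "analytic_curve X \<A>"
    and q: "q \<ge> 2"
    and M_analytic: "\<And>k. k \<in> {1..q} \<Longrightarrow> analytic_map_on \<A> (topspace X) (M k)"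
    and M_SL: "\<And>k p. k \<in> {1..q} \<Longrightarrow> p \<in> topspace X \<Longrightarrow> M k p \<in> SL"
    and S_subset: "S \<subseteq> topspace X"
    and S_isolated: "\<And>p. p \<in> S \<Longrightarrow> \<exists>T. openin X T \<and> T \<inter> S = {p}"
    and irreducible: "\<And>p. p \<in> topspace X - S \<Longrightarrow> \<not> reducible_pair (M 1 p) (M 2 p)"
  shows "(globally_unitarizable X \<A> q M \<longleftrightarrow>
          (\<forall>p\<in>topspace X. locally_unitarizable_at X \<A> q M p)) \<and>
         (\<forall>V W. simultaneous_unitarizer \<A> (topspace X) q M V \<longrightarrow>
                simultaneous_unitarizer \<A> (topspace X) q M W \<longrightarrow>
           (\<exists>Q. analytic_map_on \<A> (topspace X) Q \<and> (\<forall>p\<in>topspace X. Q p \<in> SU) \<and>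
                (\<forall>p\<in>topspace X. W p = Q p ** V p)))"
proof -
  have gram_unique: "conj_transpose (V p) ** V p = conj_transpose (W p) ** W p"
    if "openin X D" and "openin X E"
      and "simultaneous_unitarizer \<A> D q M V" and "simultaneous_unitarizer \<A> E q M W" and "p \<in> D \<inter> E"
    for V W D E p
    by (rule simultaneous_unitarizer_gram_unique[where X = X and M = M and S = S and q = q, OF curve q _ _ that])
      (fact S_isolated irreducible)+
  show ?thesis
  proof (intro conjI iffI allI impI)
    show "\<forall>p\<in>topspace X. locally_unitarizable_at X \<A> q M p" if "globally_unitarizable X \<A> q M"
      using that openin_topspace unfolding globally_unitarizable_def locally_unitarizable_at_def by blast
  next
    assume "\<forall>p\<in>topspace X. locally_unitarizable_at X \<A> q M p"
    then obtain D V where DV: "\<And>p. p \<in> topspace X \<Longrightarrow>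
        openin X (D p) \<and> p \<in> D p \<and> simultaneous_unitarizer \<A> (D p) q M (V p)"
      unfolding locally_unitarizable_at_def by metis
    have V: "openin X (D p)" "p \<in> D p" "simultaneous_unitarizer \<A> (D p) q M (V p)"
      if "p \<in> topspace X" for p
      using DV[OF that] by auto
    \<comment> \<open>The pointwise choice of \<open>V p\<close> is arbitrary, but \<open>H\<close> does not depend on it.\<close>
    define H where "H p = conj_transpose (V p p) ** V p p" for p
    have H_local: "H r = conj_transpose (V p r) ** V p r" if "p \<in> topspace X" "r \<in> D p" for p r
    proof -
      have "r \<in> topspace X"
        using that V(1) openin_subset by blast
      then show ?thesis
        unfolding H_def using V that by (intro gram_unique[of "D r" "D p" "V r" "V p"]) auto
    qed
    have H_analytic: "analytic_map_on \<A> (topspace X) H"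
    proof (rule analytic_map_on_eq_nhd[OF curve])
      fix p assume p: "p \<in> topspace X"
      then have "analytic_map_on \<A> (D p) (\<lambda>r. conj_transpose (V p r) ** V p r)"
        using V(3) by (intro analytic_map_on_gram simultaneous_unitarizer_analytic)
      then show "\<exists>E g. openin X E \<and> p \<in> E \<and> analytic_map_on \<A> E g \<and> (\<forall>r\<in>E. H r = g r)"
        using V[OF p] H_local[OF p]
        by (intro exI[of _ "D p"] exI[of _ "\<lambda>r. conj_transpose (V p r) ** V p r"]) blast
    qed
    have H_gram: "H p \<in> gram_matrices" and H_det: "det (H p) = 1" if "p \<in> topspace X" for p
    proof -
      have "det (V p p) = 1"
        using simultaneous_unitarizer_SL[OF V(3) V(2)] that by (simp add: SL_def)
      then show "H p \<in> gram_matrices" and "det (H p) = 1"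
        unfolding H_def gram_matrices_def by (auto simp: det_mul det_conj_transpose)
    qed
    obtain C :: "complex^'n^'n \<Rightarrow> complex^'n^'n" where
      C: "\<forall>H\<in>gram_matrices. det H = 1 \<longrightarrow> C H \<in> SL \<and> conj_transpose (C H) ** C H = H" and
      C_analytic: "\<forall>f S. real_analytic_on f S \<longrightarrow> f ` S \<subseteq> gram_matrices \<longrightarrow> real_analytic_on (\<lambda>x. C (f x)) S"
      using analytic_cholesky by (elim exE conjE) (rule that)
    have "simultaneous_unitarizer \<A> (topspace X) q M (\<lambda>p. C (H p))"
      unfolding simultaneous_unitarizer_def
    proof (intro conjI ballI)
      show "analytic_map_on \<A> (topspace X) (\<lambda>p. C (H p))"
        using analytic_map_on_compose_gram[OF C_analytic[rule_format] curve H_analytic H_gram] .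
      fix p assume p: "p \<in> topspace X"
      show C_SL: "C (H p) \<in> SL"
        using C H_gram H_det p by blast
      fix k assume k: "k \<in> {1..q}"
      have "conj_transpose (C (H p)) ** C (H p) = conj_transpose (V p p) ** V p p"
        using C H_gram[OF p] H_det[OF p] by (simp add: H_def)
      moreover have "det (C (H p)) \<noteq> 0"
        using C_SL by (simp add: SL_def)
      ultimately have "norm (C (H p) *v y) = norm (V p p *v y)" for y
        by (simp add: gram_eq_iff_norm_eq)
      then show "C (H p) ** M k p ** matrix_inv (C (H p)) \<in> SU"
        using simultaneous_unitarizer_norm[OF V(3)[OF p] k V(2)[OF p]] M_SL[OF k p] C_SL
        by (simp add: conjugate_in_SU_iff)
    qed
    then show "globally_unitarizable X \<A> q M"
      unfolding globally_unitarizable_def by blast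
  next
    fix V W
    assume V: "simultaneous_unitarizer \<A> (topspace X) q M V" and W: "simultaneous_unitarizer \<A> (topspace X) q M W"
    have V_det: "det (V p) = 1" and W_det: "det (W p) = 1" if "p \<in> topspace X" for p
      using V W that by (auto simp: simultaneous_unitarizer_def SL_def)
    define Q where "Q p = W p ** matrix_inv (V p)" for p
    have QV: "Q p ** V p = W p" if "p \<in> topspace X" for p
      using V_det[OF that] by (simp add: Q_def matrix_mul_assoc[symmetric] matrix_inv_left)
    have "analytic_map_on \<A> (topspace X) Q"
    proof (rule analytic_map_onI)
      fix U \<phi> assume chart: "(U, \<phi>) \<in> \<A>"
      have \<phi>: "is_chart X U \<phi>"
        using analytic_curve_chart[OF curve chart] .
      have "det (V (inv_into U \<phi> x)) \<noteq> 0" if "x \<in> \<phi> ` (U \<inter> topspace X)" for x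
        using that V_det inv_into_f_f[OF is_chart_inj_on[OF \<phi>]] by auto
      then show "real_analytic_on (\<lambda>x. Q (inv_into U \<phi> x)) (\<phi> ` (U \<inter> topspace X))"
        unfolding Q_def using V W chart
        by (intro real_analytic_on_matrix_mult real_analytic_on_matrix_inv analytic_map_onD[OF _ chart]
            is_chart_open_image[OF \<phi> openin_topspace]) (auto simp: simultaneous_unitarizer_def)
    qed
    moreover have "Q p \<in> SU" if p: "p \<in> topspace X" for p
    proof -
      have V0: "det (V p) \<noteq> 0"
        using V_det[OF p] by simp
      have "conj_transpose (V p) ** V p = conj_transpose (W p) ** W p"
        using p by (intro gram_unique[OF openin_topspace openin_topspace V W]) simp
      then have VW: "norm (V p *v x) = norm (W p *v x)" for x
        using gram_eq_iff_norm_eq[OF V0] by blast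
      have "norm (Q p *v x) = norm x" for x
      proof -
        have "norm (Q p *v x) = norm (V p *v (matrix_inv (V p) *v x))"
          by (simp add: Q_def VW flip: matrix_vector_mul_assoc)
        then show ?thesis
          by (simp add: matrix_vector_mul_assoc matrix_inv_right V0)
      qed
      moreover have "det (Q p) = 1"
        using QV[OF p] V_det[OF p] W_det[OF p] by (metis det_mul mult.right_neutral)
      ultimately show ?thesis
        by (simp add: SU_iff)
    qed
    ultimately show "\<exists>Q. analytic_map_on \<A> (topspace X) Q \<and> (\<forall>p\<in>topspace X. Q p \<in> SU) \<and>
                (\<forall>p\<in>topspace X. W p = Q p ** V p)"
      using QV by metis
  qed
qed

end
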